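(* Let $0<|q|<1$. With $S(1,1;q,N)$ the polynomial in $q$ defined in the context, the following limits hold (with $M$ running over the non-negative integers): $$\lim_{M\to\infty}S(1,1;q^{-1},3M+1)\,q^{(M+1)(3M+1)}=\sum_{a,b\ge 0}\frac{q^{a^2-3ab+3b^2+a-b}}{(q^3;q^3)_b}\begin{bmatrix}3b-a-1\\ a\end{bmatrix}_q,$$ $$\lim_{M\to\infty}S(1,1;q^{-1},3M)\,q^{M(3M+1)}=\sum_{a,b\ge 0}\frac{q^{a^2-3ab+3b^2+a-b}}{(q^3;q^3)_b}\begin{bmatrix}3b-a\\ a\end{bmatrix}_q,$$ $$\lim_{M\to\infty}S(1,1;q^{-1},3M+2)\,q^{(M+2)(3M+1)}=\sum_{a,b\ge 0}\frac{q^{a^2-3ab+3b^2+a-b-2}}{(q^3;q^3)_b}\begin{bmatrix}3b-a-2\\ a\end{bmatrix}_q.$$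
   Context: Here $q$ is a nonzero complex number with $|q|<1$, and $(x;q)_n=\prod_{i=0}^{n-1}(1-q^ix)$. For $k,l\in\mathbb{Z}$ the Gaussian binomial coefficient is $\begin{bmatrix}k\\ l\end{bmatrix}_q=\frac{(q;q)_k}{(q;q)_l(q;q)_{k-l}}$ if $k\ge l\ge 0$, and $0$ if $l<0$ or $k<l$ (in particular $\begin{bmatrix}-1\\ 0\end{bmatrix}_q=0$); the subscript $q^3$ means that $q$ is replaced by $q^3$. For an integer $N\ge 0$, $$S(1,1;q,N)=\sum_{m,n\ge 0}q^{m^2+3mn+3n^2+m+n}\begin{bmatrix}N-3n-m\\ m\end{bmatrix}_q\begin{bmatrix}\lfloor\frac23(N+1)\rfloor-m-n\\ n\end{bmatrix}_{q^3},$$ a polynomial in $q$, and $S(1,1;q^{-1},N)$ is the result of substituting $q^{-1}$ for $q$ in it. *)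

theory Defs
  imports "HOL-Analysis.Analysis"
begin

definition qpoch :: "complex \<Rightarrow> complex \<Rightarrow> nat \<Rightarrow> complex" where
  "qpoch x q n = (\<Prod>i<n. 1 - q ^ i * x)"

text \<open>
  The quotient agrees with the value of the Gaussian polynomial whenever no power
  \<open>q ^ j\<close> with \<open>j > 0\<close> equals 1. This covers every use below, where the base
  is a nonzero number off the unit circle; at roots of unity division by zero would give 0.
\<close>

definition qbinom :: "complex \<Rightarrow> int \<Rightarrow> int \<Rightarrow> complex" where
  "qbinom q k l =
     (if 0 \<le> l \<and> l \<le> k
      then qpoch q q (nat k) / (qpoch q q (nat l) * qpoch q q (nat (k - l)))
      else 0)"

definition S11_term :: "complex \<Rightarrow> nat \<Rightarrow> nat \<Rightarrow> nat \<Rightarrow> complex" where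
  "S11_term q N m n =
     q ^ (m\<^sup>2 + 3 * m * n + 3 * n\<^sup>2 + m + n)
     * qbinom q (int N - 3 * int n - int m) (int m)
     * qbinom (q ^ 3) (\<lfloor>2 / 3 * (real N + 1)\<rfloor> - int m - int n) (int n)"

text \<open>
  The sum over all \<open>m, n \<ge> 0\<close> is finite: the first binomial coefficient vanishes unless
  \<open>2 * m + 3 * n \<le> N\<close>, so the ranges can be cut off at \<open>N\<close>; see
  \<open>S11_has_sum\<close>.
\<close>

definition S11 :: "complex \<Rightarrow> nat \<Rightarrow> complex" where
  "S11 q N = (\<Sum>m\<le>N. \<Sum>n\<le>N. S11_term q N m n)"

lemma S11_has_sum: "((\<lambda>(m, n). S11_term q N m n) has_sum S11 q N) UNIV"
proof -
  have "((\<lambda>(m, n). S11_term q N m n) has_sum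
          (\<Sum>(m, n)\<in>{..N} \<times> {..N}. S11_term q N m n)) ({..N} \<times> {..N})"
    by (rule has_sum_finite) simp
  also have "(\<Sum>(m, n)\<in>{..N} \<times> {..N}. S11_term q N m n) = S11 q N"
    unfolding S11_def by (simp add: sum.cartesian_product)
  finally show ?thesis
    by (rule has_sum_cong_neutral[THEN iffD1, rotated -1])
       (auto simp: S11_term_def qbinom_def split: if_splits)
qed

end

theory Submission
  imports Defs
begin

text \<open>
  Write \<open>N = 3 * M + r\<close> with \<open>r \<in> {0, 1, 2}\<close>, so that
  \<open>\<lfloor>2 / 3 * (N + 1)\<rfloor> = 2 * M + r\<close>. Inverting the base of a Gaussian binomial
  coefficient only produces a power of \<open>q\<close> (lemma \<open>qbinom_inverse\<close>). In the sum for
  \<open>S(1,1;q\<^sup>-\<^sup>1,N)\<close>, take as new summation variables the differences of upper and lower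
  entries of the two coefficients,
  \<open>a = N - 3 * n - 2 * m\<close> and \<open>b = 2 * M + r - m - 2 * n\<close>.
  This is an invertible affine substitution, with \<open>m = 3 * b - 2 * a - r\<close> and
  \<open>n = M + r + a - 2 * b\<close>. After multiplication by \<open>q ^ ((M + r) * (3 * M + 1))\<close> all
  dependence of the exponent on \<open>M\<close> cancels, and by the symmetry of the binomial
  coefficients the summand becomes
  \[ q^{a^2-3ab+3b^2+a-b-r(r-1)} {3b-a-r \brack a}_q {M+r+a-b \brack b}_{q^3} \]
  (here \<open>r * (r - 1)\<close> is 0, 0, 2 for \<open>r = 0, 1, 2\<close>).
  Only the last factor depends on \<open>M\<close>, and it tends to \<open>1 / (q\<^sup>3;q\<^sup>3)\<^sub>b\<close>.

  The limit may be taken termwise by dominated convergence: Gaussian binomial coefficients are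
  bounded uniformly in their entries, because the partial products of \<open>(q;q)\<^sub>\<infinity>\<close> are
  bounded and bounded away from 0. Moreover, since \<open>a\<^sup>2 - 3 * a * b + 3 * b\<^sup>2 \<ge> 3 / 4 * b\<^sup>2\<close> and
  the term linear in \<open>a\<close> has a positive coefficient,
  the powers of \<open>q\<close> are dominated by a constant multiple of \<open>\<bar>q\<bar> ^ (a + b)\<close>.
\<close>

section \<open>Gaussian binomial coefficients\<close>

lemma qpoch_Suc: "qpoch x q (Suc n) = qpoch x q n * (1 - q ^ n * x)"
  by (simp add: qpoch_def)

lemma qpoch_nonzero:
  assumes "norm q < 1"
  shows "qpoch q q n \<noteq> 0"
proof -
  have "q ^ i * q \<noteq> 1" for i
  proof
    assume "q ^ i * q = 1"
    hence "norm q ^ Suc i = 1"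
      by (metis norm_one norm_power power_Suc2)
    moreover have "norm q ^ Suc i < 1"
      using assms by (subst power_less_one_iff) auto
    ultimately show False by simp
  qed
  thus ?thesis by (auto simp: qpoch_def)
qed

lemma qpoch_tendsto_nonzero:
  assumes "norm q < 1"
  obtains P where "P \<noteq> 0" "qpoch q q \<longlonglongrightarrow> P"
proof -
  have nz: "1 - q ^ i * q \<noteq> 0" for i
    using qpoch_nonzero[OF assms, of "Suc i"] by (auto simp: qpoch_Suc)
  have "summable (\<lambda>i. norm q * norm q ^ i)"
    using assms by (intro summable_mult summable_geometric) auto
  hence "abs_convergent_prod (\<lambda>i. 1 - q ^ i * q)"
    by (intro summable_imp_abs_convergent_prod) (simp add: norm_mult norm_power mult.commute)
  hence conv: "convergent_prod (\<lambda>i. 1 - q ^ i * q)"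
    by (rule abs_convergent_prod_imp_convergent_prod)
  have "(\<lambda>n. \<Prod>i\<le>n. 1 - q ^ i * q) \<longlonglongrightarrow> (\<Prod>i. 1 - q ^ i * q)"
    by (rule convergent_prod_LIMSEQ[OF conv])
  hence "(\<lambda>n. qpoch q q (Suc n)) \<longlonglongrightarrow> (\<Prod>i. 1 - q ^ i * q)"
    by (simp add: qpoch_def lessThan_Suc_atMost)
  hence "qpoch q q \<longlonglongrightarrow> (\<Prod>i. 1 - q ^ i * q)"
    by (subst (asm) filterlim_sequentially_Suc)
  moreover have "(\<Prod>i. 1 - q ^ i * q) \<noteq> 0"
    using prodinf_nonzero[OF conv] nz by blast
  ultimately show ?thesis using that by blast
qed

lemma qbinom_bounded:
  assumes "norm q < 1"
  obtains C where "\<And>k l. norm (qbinom q k l) \<le> C"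
proof -
  obtain P where P: "P \<noteq> 0" "qpoch q q \<longlonglongrightarrow> P"
    using qpoch_tendsto_nonzero[OF assms] .
  obtain A where A: "A > 0" "\<And>n. norm (qpoch q q n) \<le> A"
    using convergentI[OF P(2), THEN convergent_imp_Bseq] by (auto simp: Bseq_def)
  obtain B where B: "B > 0" "\<And>n. norm (inverse (qpoch q q n)) \<le> B"
    using convergentI[OF tendsto_inverse[OF P(2,1)], THEN convergent_imp_Bseq]
    by (auto simp: Bseq_def)
  have "norm (qbinom q k l) \<le> A * (B * B)" for k l
  proof (cases "0 \<le> l \<and> l \<le> k")
    case True
    have "qbinom q k l = qpoch q q (nat k) *
            (inverse (qpoch q q (nat l)) * inverse (qpoch q q (nat (k - l))))"
      using True by (simp add: qbinom_def field_simps)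
    thus ?thesis
      using A B by (simp only: norm_mult) (intro mult_mono; simp add: less_imp_le)
  next
    case False
    thus ?thesis using A(1) B(1) by (auto simp: qbinom_def)
  qed
  thus ?thesis using that by blast
qed

lemma qbinom_tendsto:
  fixes c :: int
  assumes "norm q < 1"
  shows "(\<lambda>M. qbinom q (int M + c) (int l)) \<longlonglongrightarrow> 1 / qpoch q q l"
proof -
  obtain P where P: "P \<noteq> 0" "qpoch q q \<longlonglongrightarrow> P"
    using qpoch_tendsto_nonzero[OF assms] .
  have shift: "filterlim (\<lambda>M. nat (int M + d)) sequentially sequentially" for d
    unfolding filterlim_at_top
  proof
    fix Z :: nat
    show "\<forall>\<^sub>F M in sequentially. Z \<le> nat (int M + d)"
      using eventually_ge_at_top[of "nat (int Z - d)"] by eventually_elim linarith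
  qed
  have "(\<lambda>M. qpoch q q (nat (int M + c)) / (qpoch q q l * qpoch q q (nat (int M + (c - int l)))))
          \<longlonglongrightarrow> P / (qpoch q q l * P)"
    using P qpoch_nonzero[OF assms]
    by (intro tendsto_intros filterlim_compose[OF P(2)] shift) auto
  also have "P / (qpoch q q l * P) = 1 / qpoch q q l"
    using P by simp
  finally show ?thesis
  proof (rule Lim_transform_eventually)
    show "\<forall>\<^sub>F M in sequentially.
            qpoch q q (nat (int M + c)) / (qpoch q q l * qpoch q q (nat (int M + (c - int l)))) =
            qbinom q (int M + c) (int l)"
      using eventually_ge_at_top[of "nat (int l - c)"]
      by eventually_elim (auto simp: qbinom_def algebra_simps)
  qed
qed

lemma qbinom_symmetric: "qbinom q k l = qbinom q k (k - l)"
  by (auto simp: qbinom_def mult.commute)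

text \<open>
  Each factor satisfies \<open>1 - q\<^sup>-\<^sup>j = - q\<^sup>-\<^sup>j * (1 - q\<^sup>j)\<close>; the power of \<open>q\<close> below is what
  remains of the prefactors in the quotient.
\<close>

lemma qbinom_inverse:
  assumes "q \<noteq> 0"
  shows "qbinom (inverse q) k l = q powi (- (l * (k - l))) * qbinom q k l"
proof (cases "0 \<le> l \<and> l \<le> k")
  case True
  define t where "t = (\<lambda>n. \<Prod>i<n. - (inverse q ^ Suc i))"
  have t_nz: "t n \<noteq> 0" for n
    using assms by (auto simp: t_def)
  have "1 - inverse q ^ i * inverse q = - (inverse q ^ Suc i) * (1 - q ^ i * q)" for i
    using assms by (simp add: field_simps)
  hence qpoch_inv: "qpoch (inverse q) (inverse q) n = t n * qpoch q q n" for n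
    by (simp only: qpoch_def t_def prod.distrib)
  have t_add: "t (u + v) = inverse q ^ (u * v) * (t u * t v)" for u v
  proof (induction v)
    case 0
    show ?case by (simp add: t_def)
  next
    case (Suc v)
    have "t (u + Suc v) = t (u + v) * - (inverse q ^ (u + Suc v))"
      by (simp add: t_def)
    also have "\<dots> = inverse q ^ (u * Suc v) * (t u * (t v * - (inverse q ^ Suc v)))"
      unfolding Suc.IH by (simp add: power_add algebra_simps)
    also have "t v * - (inverse q ^ Suc v) = t (Suc v)"
      by (simp add: t_def)
    finally show ?case .
  qed
  obtain u v where uv: "l = int u" "k = int (u + v)"
    using True by (metis zero_le_imp_eq_int le_iff_diff_le_0 diff_ge_0_iff_ge add.commute
        diff_add_cancel of_nat_add)
  have "q powi (- (l * (k - l))) = inverse q ^ (u * v)"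
    using uv by (simp add: power_int_minus power_inverse flip: of_nat_mult)
  moreover have "nat k = u + v" "nat l = u" "nat (k - l) = v"
    using uv by auto
  ultimately show ?thesis
    using True t_nz by (simp add: qbinom_def qpoch_inv t_add)
qed (auto simp: qbinom_def)

section \<open>The change of summation variables\<close>

text \<open>
  The summand of the transformed sum. The second binomial coefficient vanishes for
  \<open>2 * b > M + r + a\<close>, that is when the original variable \<open>n\<close> would be negative;
  the first one vanishes when \<open>m\<close> would be.
\<close>

definition dual_term :: "complex \<Rightarrow> nat \<Rightarrow> nat \<Rightarrow> nat \<times> nat \<Rightarrow> complex" where
  "dual_term q r M = (\<lambda>(a, b).
     q powi ((int a)\<^sup>2 - 3 * int a * int b + 3 * (int b)\<^sup>2 + int a - int b - int r * (int r - 1))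
     * qbinom q (3 * int b - int a - int r) (int a)
     * qbinom (q ^ 3) (int M + (int r + int a - int b)) (int b))"

lemma floor_two_thirds:
  assumes "r \<le> 2"
  shows "\<lfloor>2 / 3 * (real (3 * M + r) + 1)\<rfloor> = 2 * int M + int r"
proof -
  have "r = 0 \<or> r = 1 \<or> r = 2" using assms by auto
  thus ?thesis by (elim disjE) (intro floor_unique; simp)+
qed

text \<open>
  In each Gaussian coefficient the lower entry is replaced by its complement
  (\<open>m\<close> by \<open>a\<close>, and \<open>n\<close> by \<open>b\<close>), because it is the fixed lower
  entry \<open>b\<close> that gives the second coefficient a limit as \<open>M\<close> grows.
\<close>

lemma S11_term_inverse:
  assumes q: "q \<noteq> 0" and r: "r \<le> 2"
    and m: "int m = 3 * int b - 2 * int a - int r"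
    and n: "int n = int M + int r + int a - 2 * int b"
  shows "S11_term (inverse q) (3 * M + r) m n * q ^ ((M + r) * (3 * M + 1)) =
         dual_term q r M (a, b)"
proof -
  define e where "e = int m ^ 2 + 3 * int m * int n + 3 * int n ^ 2 + int m + int n"
  have top: "int (3 * M + r) - 3 * int n - int m = 3 * int b - int a - int r"
    using m n by simp
  have "qbinom (inverse q) (3 * int b - int a - int r) (int m) =
      q powi (- (int m * int a)) * qbinom q (3 * int b - int a - int r) (int a)"
    using qbinom_symmetric[of q "3 * int b - int a - int r" "int m"] m
    by (simp add: qbinom_inverse[OF q])
  hence first: "qbinom (inverse q) (int (3 * M + r) - 3 * int n - int m) (int m) =
      q powi (- (int m * int a)) * qbinom q (3 * int b - int a - int r) (int a)"
    unfolding top .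
  have "\<lfloor>2 / 3 * (real (3 * M + r) + 1)\<rfloor> - int m - int n = int M + (int r + int a - int b)"
    unfolding floor_two_thirds[OF r] using m n by simp
  moreover have "qbinom (inverse q ^ 3) (int M + (int r + int a - int b)) (int n) =
      (q ^ 3) powi (- (int n * int b)) * qbinom (q ^ 3) (int M + (int r + int a - int b)) (int b)"
  proof -
    have diff: "int M + (int r + int a - int b) - int n = int b"
      using n by simp
    show ?thesis
      using qbinom_inverse[of "q ^ 3" "int M + (int r + int a - int b)" "int n"]
        qbinom_symmetric[of "q ^ 3" "int M + (int r + int a - int b)" "int n"] q
      unfolding diff by (simp add: power_inverse)
  qed
  moreover have "(q ^ 3) powi (- (int n * int b)) = q powi (- (3 * int n * int b))"
    using power_int_mult[of q 3 "- (int n * int b)"] by (simp add: mult.assoc)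
  ultimately have second: "qbinom (inverse q ^ 3)
        (\<lfloor>2 / 3 * (real (3 * M + r) + 1)\<rfloor> - int m - int n) (int n) =
      q powi (- (3 * int n * int b)) * qbinom (q ^ 3) (int M + (int r + int a - int b)) (int b)"
    by simp
  have power_mn: "inverse q ^ (m\<^sup>2 + 3 * m * n + 3 * n\<^sup>2 + m + n) = q powi (- e)"
  proof -
    have "e = int (m\<^sup>2 + 3 * m * n + 3 * n\<^sup>2 + m + n)"
      by (simp add: e_def)
    thus ?thesis
      by (simp only: power_int_minus power_int_of_nat power_inverse)
  qed
  have "(int M + int r) * (3 * int M + 1) = int ((M + r) * (3 * M + 1))"
    by (simp add: algebra_simps)
  hence power_M: "q ^ ((M + r) * (3 * M + 1)) = q powi ((int M + int r) * (3 * int M + 1))"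
    by (simp only: power_int_of_nat)
  have "S11_term (inverse q) (3 * M + r) m n * q ^ ((M + r) * (3 * M + 1)) =
      (q powi (- e) * q powi (- (int m * int a)) * q powi (- (3 * int n * int b))
        * q powi ((int M + int r) * (3 * int M + 1)))
      * qbinom q (3 * int b - int a - int r) (int a)
      * qbinom (q ^ 3) (int M + (int r + int a - int b)) (int b)"
    unfolding S11_term_def first second power_mn power_M by (simp only: mult_ac)
  also have "q powi (- e) * q powi (- (int m * int a)) * q powi (- (3 * int n * int b))
        * q powi ((int M + int r) * (3 * int M + 1)) =
      q powi (- e - int m * int a - 3 * int n * int b + (int M + int r) * (3 * int M + 1))"
    by (simp only: diff_conv_add_uminus power_int_add[OF disjI1[OF q]])
  also have "- e - int m * int a - 3 * int n * int b + (int M + int r) * (3 * int M + 1) =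
      (int a)\<^sup>2 - 3 * int a * int b + 3 * (int b)\<^sup>2 + int a - int b - int r * (int r - 1)"
    unfolding e_def m n by (simp add: power2_eq_square algebra_simps)
  finally show ?thesis by (simp add: dual_term_def)
qed

lemma dual_term_has_sum:
  assumes q: "q \<noteq> 0" and r: "r \<le> 2"
  shows "(dual_term q r M has_sum S11 (inverse q) (3 * M + r) * q ^ ((M + r) * (3 * M + 1))) UNIV"
proof -
  define A where "A = {(a, b). 2 * int a + int r \<le> 3 * int b \<and> 2 * int b \<le> int M + int r + int a}"
  define B where "B = {(m, n). 2 * int m + 3 * int n \<le> 3 * int M + int r \<and>
                               int m + 2 * int n \<le> 2 * int M + int r}"
  define to_mn where "to_mn = (\<lambda>(a, b). (nat (3 * int b - 2 * int a - int r),
                                          nat (int M + int r + int a - 2 * int b)))"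
  define to_ab where "to_ab = (\<lambda>(m, n). (nat (3 * int M + int r - 2 * int m - 3 * int n),
                                          nat (2 * int M + int r - int m - 2 * int n)))"
  define f where "f = (\<lambda>(m, n). S11_term (inverse q) (3 * M + r) m n * q ^ ((M + r) * (3 * M + 1)))"
  define s where "s = S11 (inverse q) (3 * M + r) * q ^ ((M + r) * (3 * M + 1))"
  have "(f has_sum s) UNIV"
    using has_sum_cmult_left[OF S11_has_sum[of "inverse q" "3 * M + r"],
        of "q ^ ((M + r) * (3 * M + 1))"]
    by (simp add: f_def s_def case_prod_unfold)
  also have "(f has_sum s) UNIV \<longleftrightarrow> (f has_sum s) B"
  proof (rule has_sum_cong_neutral)
    fix x assume "x \<in> UNIV - B"
    thus "f x = 0"
      unfolding f_def B_def S11_term_def floor_two_thirds[OF r]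
      by (auto simp: qbinom_def split: if_splits)
  qed auto
  also have "(f has_sum s) B \<longleftrightarrow> (dual_term q r M has_sum s) A"
  proof (rule has_sum_reindex_bij_witness[where i = to_mn and j = to_ab])
    fix x assume "x \<in> B"
    then obtain m n where x: "x = (m, n)" and
      le: "2 * int m + 3 * int n \<le> 3 * int M + int r" "int m + 2 * int n \<le> 2 * int M + int r"
      by (auto simp: B_def)
    obtain a b where ab: "to_ab x = (a, b)" by fastforce
    have "int a = 3 * int M + int r - 2 * int m - 3 * int n"
         "int b = 2 * int M + int r - int m - 2 * int n"
      using ab le by (auto simp: to_ab_def x)
    hence mn: "int m = 3 * int b - 2 * int a - int r" "int n = int M + int r + int a - 2 * int b"
      by auto
    show "to_mn (to_ab x) = x"
      by (simp add: ab) (simp add: to_mn_def x flip: mn)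
    show "to_ab x \<in> A"
      using mn by (auto simp: ab A_def)
    show "dual_term q r M (to_ab x) = f x"
      unfolding ab using S11_term_inverse[OF q r mn] by (simp add: f_def x)
  qed (auto simp: A_def B_def to_mn_def to_ab_def)
  also have "(dual_term q r M has_sum s) A \<longleftrightarrow> (dual_term q r M has_sum s) UNIV"
  proof (rule has_sum_cong_neutral)
    fix x assume "x \<in> UNIV - A"
    then obtain a b where x: "x = (a, b)"
      and "\<not> 2 * int a + int r \<le> 3 * int b \<or> \<not> 2 * int b \<le> int M + int r + int a"
      by (auto simp: A_def)
    hence "\<not> int a \<le> 3 * int b - int a - int r \<or> \<not> int b \<le> int M + (int r + int a - int b)"
      by linarith
    hence "qbinom q (3 * int b - int a - int r) (int a) = 0 \<or>
           qbinom (q ^ 3) (int M + (int r + int a - int b)) (int b) = 0"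
      unfolding qbinom_def by argo
    thus "dual_term q r M x = 0"
      by (auto simp: dual_term_def x)
  qed auto
  finally show ?thesis by (simp add: s_def)
qed

section \<open>Passage to the limit\<close>

text \<open>Tannery's theorem for unordered sums over an arbitrary index set.\<close>

lemma has_sum_dominated_convergence:
  fixes f :: "nat \<Rightarrow> 'a \<Rightarrow> 'b :: banach" and h :: "'a \<Rightarrow> real"
  assumes lim: "\<And>x. x \<in> A \<Longrightarrow> (\<lambda>n. f n x) \<longlonglongrightarrow> g x"
    and bound: "\<And>n x. x \<in> A \<Longrightarrow> norm (f n x) \<le> h x"
    and h: "h summable_on A"
    and sums: "\<And>n. (f n has_sum s n) A"
  shows "\<exists>L. (g has_sum L) A \<and> s \<longlonglongrightarrow> L"
proof -
  have g_bound: "norm (g x) \<le> h x" if "x \<in> A" for x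
    using tendsto_norm[OF lim[OF that]] bound[OF that]
    by (intro Lim_bounded) auto
  hence "g summable_on A"
    by (rule abs_summable_summable[OF Infinite_Sum.abs_summable_on_comparison_test'[OF h]])
  then obtain L where L: "(g has_sum L) A"
    by (auto simp: summable_on_def)
  have "s \<longlonglongrightarrow> L"
  proof (rule swap_uniform_limit')
    show "\<forall>\<^sub>F X in finite_subsets_at_top A. (\<lambda>n. \<Sum>x\<in>X. f n x) \<longlonglongrightarrow> (\<Sum>x\<in>X. g x)"
      by (rule eventually_finite_subsets_at_top_weakI) (auto intro!: tendsto_sum lim)
    show "((\<lambda>X. \<Sum>x\<in>X. g x) \<longlongrightarrow> L) (finite_subsets_at_top A)"
      using L by (simp add: has_sum_def)
    show "uniform_limit UNIV (\<lambda>X n. \<Sum>x\<in>X. f n x) s (finite_subsets_at_top A)"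
      by (rule Weierstrass_m_test_general'[OF bound sums h])
  qed auto
  with L show ?thesis by blast
qed

lemma summable_on_power_add:
  fixes x :: real
  assumes "0 \<le> x" "x < 1"
  shows "(\<lambda>(a :: nat, b :: nat). x ^ (a + b)) summable_on UNIV"
proof -
  have geometric: "((\<lambda>n. x ^ n) has_sum (1 / (1 - x))) UNIV"
    using assms by (intro sums_nonneg_imp_has_sum geometric_sums) auto
  have "(\<lambda>(a :: nat, b :: nat). x ^ (a + b)) summable_on Sigma UNIV (\<lambda>_. UNIV)"
  proof (rule summable_on_SigmaI)
    fix a :: nat
    show "((\<lambda>b. case (a, b) of (a, b) \<Rightarrow> x ^ (a + b)) has_sum (x ^ a * (1 / (1 - x)))) UNIV"
      using has_sum_cmult_right[OF geometric, of "x ^ a"] by (simp add: power_add)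
  next
    show "(\<lambda>a. x ^ a * (1 / (1 - x))) summable_on UNIV"
      using geometric by (intro summable_on_cmult_left) (auto simp: summable_on_def)
  qed (use assms in auto)
  thus ?thesis by simp
qed

lemma quadratic_exponent_ge:
  fixes a b :: int
  shows "a + b - 4 \<le> a\<^sup>2 - 3 * a * b + 3 * b\<^sup>2 + a - b"
proof -
  have "4 * (a\<^sup>2 - 3 * a * b + 3 * b\<^sup>2 + a - b - (a + b - 4)) =
        (2 * a - 3 * b)\<^sup>2 + 2 * (b - 2)\<^sup>2 + b\<^sup>2 + 8"
    by (simp add: power2_eq_square algebra_simps)
  also have "\<dots> \<ge> 0" by simp
  finally show ?thesis by simp
qed

lemma dual_term_bounded:
  assumes "0 < norm q" "norm q < 1"
  obtains K where "\<And>M a b. norm (dual_term q r M (a, b)) \<le> K * norm q ^ (a + b)"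
proof -
  have "norm (q ^ 3) < 1"
    using assms by (simp add: norm_power power_less_one_iff)
  then obtain C where C: "\<And>k l. norm (qbinom (q ^ 3) k l) \<le> C"
    using qbinom_bounded by blast
  obtain D where D: "\<And>k l. norm (qbinom q k l) \<le> D"
    using qbinom_bounded[OF assms(2)] by blast
  define d where "d = int r * (int r - 1)"
  have "norm (dual_term q r M (a, b)) \<le> (norm q powi (- 4 - d) * D * C) * norm q ^ (a + b)" for M a b
  proof -
    define e where "e = (int a)\<^sup>2 - 3 * int a * int b + 3 * (int b)\<^sup>2 + int a - int b - d"
    have "norm q powi e \<le> norm q powi (int a + int b - 4 - d)"
      using assms quadratic_exponent_ge[of "int a" "int b"]
      by (intro power_int_decreasing) (auto simp: e_def)
    also have "int a + int b - 4 - d = (- 4 - d) + int (a + b)"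
      by simp
    also have "norm q powi \<dots> = norm q powi (- 4 - d) * norm q ^ (a + b)"
      using assms by (subst power_int_add) (auto simp flip: power_int_of_nat)
    finally have "norm (q powi e) \<le> norm q powi (- 4 - d) * norm q ^ (a + b)"
      by (simp add: norm_power_int)
    hence "norm (dual_term q r M (a, b)) \<le> norm q powi (- 4 - d) * norm q ^ (a + b) * D * C"
      unfolding dual_term_def prod.case norm_mult e_def d_def
      using order.trans[OF norm_ge_zero D]
      by (intro mult_mono C D) (auto intro!: mult_nonneg_nonneg)
    thus ?thesis by (simp add: mult_ac)
  qed
  thus ?thesis using that by blast
qed

lemma S11_inverse_limit:
  assumes q: "0 < norm q" "norm q < 1" and r: "r \<le> 2"
  shows "\<exists>L. ((\<lambda>(a :: nat, b :: nat).
          q powi ((int a)\<^sup>2 - 3 * int a * int b + 3 * (int b)\<^sup>2 + int a - int b - int r * (int r - 1))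
          / qpoch (q ^ 3) (q ^ 3) b * qbinom q (3 * int b - int a - int r) (int a)) has_sum L) UNIV
        \<and> (\<lambda>M. S11 (inverse q) (3 * M + r) * q ^ ((M + r) * (3 * M + 1))) \<longlonglongrightarrow> L"
proof -
  obtain K where K: "\<And>M a b. norm (dual_term q r M (a, b)) \<le> K * norm q ^ (a + b)"
    using dual_term_bounded[OF q] by blast
  show ?thesis
  proof (rule has_sum_dominated_convergence[where f = "dual_term q r"
        and h = "\<lambda>(a, b). K * norm q ^ (a + b)"])
    fix x :: "nat \<times> nat"
    obtain a b where x: "x = (a, b)" by fastforce
    have "norm (q ^ 3) < 1"
      using q by (simp add: norm_power power_less_one_iff)
    from qbinom_tendsto[OF this, of "int r + int a - int b" b]
    show "(\<lambda>M. dual_term q r M x) \<longlonglongrightarrow> (case x of (a, b) \<Rightarrow>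
          q powi ((int a)\<^sup>2 - 3 * int a * int b + 3 * (int b)\<^sup>2 + int a - int b - int r * (int r - 1))
          / qpoch (q ^ 3) (q ^ 3) b * qbinom q (3 * int b - int a - int r) (int a))"
      unfolding x dual_term_def prod.case by (auto intro!: tendsto_eq_intros)
  next
    show "norm (dual_term q r M x) \<le> (case x of (a, b) \<Rightarrow> K * norm q ^ (a + b))" for M x
      using K by (cases x) simp
  next
    show "(\<lambda>(a, b). K * norm q ^ (a + b)) summable_on UNIV"
      using summable_on_cmult_right[OF summable_on_power_add[of "norm q"], of K] q
      by (simp add: case_prod_unfold)
  next
    show "(dual_term q r M has_sum
            S11 (inverse q) (3 * M + r) * q ^ ((M + r) * (3 * M + 1))) UNIV" for M
      using q r by (intro dual_term_has_sum) auto
  qed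
qed

theorem theorem5p1:
  fixes q :: complex
  assumes "0 < norm q" and "norm q < 1"
  shows
    "(\<exists>L. ((\<lambda>(a :: nat, b :: nat).
          q powi ((int a)\<^sup>2 - 3 * int a * int b + 3 * (int b)\<^sup>2 + int a - int b)
          / qpoch (q ^ 3) (q ^ 3) b * qbinom q (3 * int b - int a - 1) (int a)) has_sum L) UNIV
        \<and> (\<lambda>M. S11 (inverse q) (3 * M + 1) * q ^ ((M + 1) * (3 * M + 1))) \<longlonglongrightarrow> L)
   \<and> (\<exists>L. ((\<lambda>(a :: nat, b :: nat).
          q powi ((int a)\<^sup>2 - 3 * int a * int b + 3 * (int b)\<^sup>2 + int a - int b)
          / qpoch (q ^ 3) (q ^ 3) b * qbinom q (3 * int b - int a) (int a)) has_sum L) UNIV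
        \<and> (\<lambda>M. S11 (inverse q) (3 * M) * q ^ (M * (3 * M + 1))) \<longlonglongrightarrow> L)
   \<and> (\<exists>L. ((\<lambda>(a :: nat, b :: nat).
          q powi ((int a)\<^sup>2 - 3 * int a * int b + 3 * (int b)\<^sup>2 + int a - int b - 2)
          / qpoch (q ^ 3) (q ^ 3) b * qbinom q (3 * int b - int a - 2) (int a)) has_sum L) UNIV
        \<and> (\<lambda>M. S11 (inverse q) (3 * M + 2) * q ^ ((M + 2) * (3 * M + 1))) \<longlonglongrightarrow> L)"
  using S11_inverse_limit[OF assms, of 1] S11_inverse_limit[OF assms, of 0]
    S11_inverse_limit[OF assms, of 2]
  by simp

end
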